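(* Let $c\in\{-1,+1\}$, let $f\in C^1(\mathbb{R},\mathbb{R})$ with $f'>0$ on $\mathbb{R}$ and $f(0)=0$, and let $D\in\mathbb{R}$. Let $y_0\in H^1((-1,0),\mathbb{R})$ and let $y\in H^1_{loc}((-1,+\infty),\mathbb{R})$ be the solution of $$y'(t)+c\,y'(t-1)+f(y(t))=D,\quad t>0,\ t\notin\mathbb{N},\qquad y(t)=y_0(t),\quad -1<t<0 .$$ Then three cases occur: 1. If $D=f(d)$ for some $d\in\mathbb{R}$, then the constant $d$ is the unique globally attractive solution (i.e. for every initial datum $y_0$, $y(t)\to d$ as $t\to+\infty$). 2. If $D>\sup f$ (respectively $D<\inf f$), then $\displaystyle\lim_{t\to+\infty}y(t)=+\infty$ (respectively $-\infty$). 3. If $D=\sup f$ (or $D=\inf f$), then $y$ does not converge towards a constant (in $\mathbb{R}$) as $t\to+\infty$.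
   Context: The equation is a neutral delay differential equation with delay $1$; it is understood to hold for almost every $t>0$ (derivatives are weak derivatives). Functions in $H^1_{loc}$ are identified with their continuous representatives. The suprema and infima of $f$ are over $\mathbb{R}$. *)

theory Defs
  imports "HOL-Analysis.Analysis"
begin

definition test_function_on :: "real set \<Rightarrow> (real \<Rightarrow> real) \<Rightarrow> bool" where
  "test_function_on S \<phi> \<longleftrightarrow>
     (\<forall>n x. ((deriv ^^ n) \<phi>) differentiable (at x)) \<and>
     (\<exists>K. compact K \<and> K \<subseteq> S \<and> (\<forall>x. x \<notin> K \<longrightarrow> \<phi> x = 0))"

definition weak_deriv_on :: "real set \<Rightarrow> (real \<Rightarrow> real) \<Rightarrow> (real \<Rightarrow> real) \<Rightarrow> bool" where
  "weak_deriv_on S u v \<longleftrightarrow>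
     (\<forall>K. compact K \<and> K \<subseteq> S \<longrightarrow> u absolutely_integrable_on K \<and> v absolutely_integrable_on K) \<and>
     (\<forall>\<phi>. test_function_on S \<phi> \<longrightarrow>
        (LINT x:S|lebesgue. u x * deriv \<phi> x) = - (LINT x:S|lebesgue. v x * \<phi> x))"

definition L2_on :: "real set \<Rightarrow> (real \<Rightarrow> real) \<Rightarrow> bool" where
  "L2_on S u \<longleftrightarrow> set_borel_measurable lebesgue S u \<and> set_integrable lebesgue S (\<lambda>x. (u x)\<^sup>2)"

(* Elements of the Sobolev spaces below are given by their continuous representatives;
   values outside the open set S are irrelevant. *)

definition H1_on :: "real set \<Rightarrow> (real \<Rightarrow> real) \<Rightarrow> bool" where
  "H1_on S u \<longleftrightarrow> continuous_on S u \<and> L2_on S u \<and> (\<exists>v. weak_deriv_on S u v \<and> L2_on S v)"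

definition H1loc_on :: "real set \<Rightarrow> (real \<Rightarrow> real) \<Rightarrow> bool" where
  "H1loc_on S u \<longleftrightarrow> continuous_on S u \<and>
     (\<forall>K. compact K \<and> K \<subseteq> S \<longrightarrow> L2_on K u) \<and>
     (\<exists>v. weak_deriv_on S u v \<and> (\<forall>K. compact K \<and> K \<subseteq> S \<longrightarrow> L2_on K v))"

(* The choice of y' does not matter: weak derivatives are unique almost everywhere.
   Continuity of y on the whole of (-1, infinity) encodes the matching y(0+) = y0(0-). *)
definition ndde_solution ::
  "real \<Rightarrow> (real \<Rightarrow> real) \<Rightarrow> real \<Rightarrow> (real \<Rightarrow> real) \<Rightarrow> (real \<Rightarrow> real) \<Rightarrow> bool" where
  "ndde_solution c f D y0 y \<longleftrightarrow>
     H1loc_on {-1<..} y \<and>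
     (\<forall>t\<in>{-1<..<0}. y t = y0 t) \<and>
     (\<exists>y'. weak_deriv_on {-1<..} y y' \<and>
        (AE t in lebesgue. 0 < t \<and> t \<notin> \<nat> \<longrightarrow> y' t + c * y' (t - 1) + f (y t) = D))"

(* Only constant solutions are considered: when one constant attracts all solutions,
   every solution attracts all others, so uniqueness is meant among constants. *)
definition globally_attractive :: "real \<Rightarrow> (real \<Rightarrow> real) \<Rightarrow> real \<Rightarrow> real \<Rightarrow> bool" where
  "globally_attractive c f D d \<longleftrightarrow>
     ndde_solution c f D (\<lambda>_. d) (\<lambda>_. d) \<and>
     (\<forall>y0 y. H1_on {-1<..<0} y0 \<and> ndde_solution c f D y0 y \<longrightarrow> (y \<longlongrightarrow> d) at_top)"

end

theory Submission
  imports Defs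
begin

text \<open>
  Put \<open>g = f - D\<close> and let \<open>G\<close> be an antiderivative of \<open>g\<close>. Squaring \<open>y' t + g (y t) = - c * y' (t - 1)\<close>
  shows that the energy \<open>E t\<close>, the integral of \<open>y'\<^sup>2\<close> over \<open>{t - 1..t}\<close> plus \<open>2 * G (y t)\<close>, satisfies
  \<open>E' t = - (g (y t))\<^sup>2\<close>. If \<open>g d = 0\<close>, then \<open>G\<close> is bounded below, so \<open>y\<close> is uniformly continuous and
  \<open>(g \<circ> y)\<^sup>2\<close> is integrable, whence \<open>y \<longlongrightarrow> d\<close>. If \<open>g\<close> is bounded away from \<open>0\<close>, then \<open>G (y t)\<close> tends
  to \<open>-\<infinity>\<close>. A finite limit of \<open>y\<close> keeps the energy bounded below and hence is a zero of \<open>g\<close>.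
\<close>

section \<open>Smooth functions\<close>

text \<open>The finite order \<open>n\<close> makes the closure properties below provable by
  induction on \<open>n\<close>; smoothness of a test function is then the statement for every
  \<open>n\<close>.\<close>

definition times_differentiable :: "nat \<Rightarrow> (real \<Rightarrow> real) \<Rightarrow> bool" where
  "times_differentiable n f \<longleftrightarrow> (\<forall>k<n. \<forall>x. (deriv ^^ k) f differentiable (at x))"

lemma times_differentiable_0 [simp]: "times_differentiable 0 f"
  by (simp add: times_differentiable_def)

lemma times_differentiable_Suc:
  "times_differentiable (Suc n) f \<longleftrightarrow> (\<forall>x. f differentiable (at x)) \<and> times_differentiable n (deriv f)"
  by (simp add: times_differentiable_def All_less_Suc2 funpow_Suc_right del: funpow.simps)

lemma times_differentiable_SucI:
  assumes "\<And>x. (f has_real_derivative f' x) (at x)" "times_differentiable n f'"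
  shows "times_differentiable (Suc n) f"
proof -
  have "deriv f = f'" using assms(1) DERIV_imp_deriv by blast
  then show ?thesis using assms by (auto simp: times_differentiable_Suc real_differentiable_def)
qed

lemma times_differentiable_SucE:
  assumes "times_differentiable (Suc n) f"
  shows "(f has_real_derivative deriv f x) (at x)" "times_differentiable n (deriv f)"
  using assms by (auto simp: times_differentiable_Suc real_differentiable_def DERIV_deriv_iff_real_differentiable)

lemma times_differentiable_SucD: "times_differentiable (Suc n) f \<Longrightarrow> times_differentiable n f"
  by (simp add: times_differentiable_def)

lemma times_differentiable_add:
  "times_differentiable n f \<Longrightarrow> times_differentiable n g \<Longrightarrow> times_differentiable n (\<lambda>x. f x + g x)"
proof (induction n arbitrary: f g)
  case (Suc n)
  note d = times_differentiable_SucE[OF Suc.prems(1)] times_differentiable_SucE[OF Suc.prems(2)]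
  show ?case
    by (rule times_differentiable_SucI[where f' = "\<lambda>x. deriv f x + deriv g x"])
      (auto intro!: derivative_intros d Suc.IH)
qed simp

lemma times_differentiable_mult:
  "times_differentiable n f \<Longrightarrow> times_differentiable n g \<Longrightarrow> times_differentiable n (\<lambda>x. f x * g x)"
proof (induction n arbitrary: f g)
  case (Suc n)
  note d = times_differentiable_SucE[OF Suc.prems(1)] times_differentiable_SucE[OF Suc.prems(2)]
  show ?case
    by (rule times_differentiable_SucI[where f' = "\<lambda>x. deriv f x * g x + deriv g x * f x"])
      (auto intro!: derivative_intros d Suc.IH times_differentiable_add
         Suc.prems[THEN times_differentiable_SucD])
qed simp

lemma times_differentiable_const: "times_differentiable n (\<lambda>x. a)"
proof (induction n arbitrary: a)
  case (Suc n)
  show ?case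
    by (rule times_differentiable_SucI[where f' = "\<lambda>x. 0"]) (auto intro: Suc.IH)
qed simp

lemma times_differentiable_inverse:
  "times_differentiable n f \<Longrightarrow> (\<And>x. f x \<noteq> 0) \<Longrightarrow> times_differentiable n (\<lambda>x. inverse (f x))"
proof (induction n)
  case (Suc n)
  note d = times_differentiable_SucE[OF Suc.prems(1)]
  have I: "times_differentiable n (\<lambda>x. inverse (f x))"
    using Suc times_differentiable_SucD by blast
  show ?case
  proof (rule times_differentiable_SucI)
    show "((\<lambda>x. inverse (f x)) has_real_derivative - 1 * deriv f x * inverse (f x) * inverse (f x)) (at x)" for x
      by (auto intro!: derivative_eq_intros d Suc.prems)
    show "times_differentiable n (\<lambda>x. - 1 * deriv f x * inverse (f x) * inverse (f x))"
      by (intro times_differentiable_mult times_differentiable_const d I)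
  qed
qed simp

lemma times_differentiable_affine:
  "times_differentiable n f \<Longrightarrow> times_differentiable n (\<lambda>x. f (a * x + b))"
proof (induction n arbitrary: f)
  case (Suc n)
  note d = times_differentiable_SucE[OF Suc.prems(1)]
  show ?case
  proof (rule times_differentiable_SucI)
    show "((\<lambda>x. f (a * x + b)) has_real_derivative deriv f (a * x + b) * a) (at x)" for x
      by (rule DERIV_chain2[OF d(1)]) (auto intro!: derivative_eq_intros)
    show "times_differentiable n (\<lambda>x. deriv f (a * x + b) * a)"
      by (intro times_differentiable_mult times_differentiable_const Suc.IH d)
  qed
qed simp

section \<open>A smooth step built from \<open>exp (- 1 / x)\<close>, and test functions made of
  it\<close>

definition flat :: "real poly \<Rightarrow> real \<Rightarrow> real" where
  "flat p x = (if x > 0 then poly p (1 / x) * exp (- 1 / x) else 0)"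

lemma tendsto_poly_mult_exp_uminus: "((\<lambda>u::real. poly p u * exp (- u)) \<longlongrightarrow> 0) at_top"
proof -
  have "((\<lambda>u. \<Sum>i\<le>degree p. coeff p i * (u ^ i / exp u)) \<longlongrightarrow> (\<Sum>i\<le>degree p. coeff p i * 0)) at_top"
    by (intro tendsto_sum tendsto_mult tendsto_const tendsto_power_div_exp_0)
  then show ?thesis
    by (simp add: poly_altdef exp_minus sum_distrib_right divide_inverse mult.assoc)
qed

text \<open>With \<open>u = 1 / x\<close>, differentiating \<open>poly p u * exp (- u)\<close> gives
  \<open>u\<^sup>2 * poly (p - pderiv p) u * exp (- u)\<close>, so the family \<open>flat p\<close>
  is closed under differentiation and its smoothness follows by induction with \<open>p\<close>
  arbitrary. At 0 the exponential beats every polynomial in \<open>u\<close>.\<close>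

lemma flat_has_derivative:
  "(flat p has_real_derivative flat ([:0, 0, 1:] * (p - pderiv p)) x) (at x)"
proof (cases x "0::real" rule: linorder_cases)
  case greater
  have "((\<lambda>x. poly p (1 / x) * exp (- 1 / x)) has_real_derivative
      flat ([:0, 0, 1:] * (p - pderiv p)) x) (at x)"
    using greater
    by (auto intro!: derivative_eq_intros DERIV_chain2[OF poly_DERIV] simp: flat_def field_simps power2_eq_square)
  then show ?thesis
    by (rule DERIV_cong_ev[THEN iffD1, rotated -1])
      (use greater in \<open>auto simp: flat_def intro!: eventually_mono[OF eventually_nhds_in_open[of "{0<..}"]]\<close>)
next
  case less
  have "((\<lambda>x. 0) has_real_derivative flat ([:0, 0, 1:] * (p - pderiv p)) x) (at x)"
    using less by (auto simp: flat_def)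
  then show ?thesis
    by (rule DERIV_cong_ev[THEN iffD1, rotated -1])
      (use less in \<open>auto simp: flat_def intro!: eventually_mono[OF eventually_nhds_in_open[of "{..<0}"]]\<close>)
next
  case equal
  have "((\<lambda>y. flat p y / y) \<longlongrightarrow> 0) (at_left 0)"
    by (rule tendsto_eventually) (auto simp: flat_def eventually_at_filter)
  moreover have "((\<lambda>y. flat p y / y) \<longlongrightarrow> 0) (at_right 0)"
  proof -
    \<comment> \<open>Dividing \<open>flat p y\<close> by \<open>y\<close> adds one power of
      \<open>inverse y\<close>, hence \<open>pCons 0 p\<close>.\<close>
    have "((\<lambda>y. poly (pCons 0 p) (inverse y) * exp (- inverse y)) \<longlongrightarrow> 0) (at_right 0)"
      by (rule filterlim_compose[OF tendsto_poly_mult_exp_uminus filterlim_inverse_at_top_right])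
    then show ?thesis
      by (rule Lim_transform_eventually)
        (auto simp: flat_def eventually_at_filter divide_simps)
  qed
  ultimately show ?thesis
    using equal by (simp add: has_field_derivative_iff filterlim_at_split flat_def)
qed

lemma times_differentiable_flat: "times_differentiable n (flat p)"
proof (induction n arbitrary: p)
  case (Suc n)
  show ?case by (rule times_differentiable_SucI[OF flat_has_derivative Suc.IH])
qed simp

text \<open>The denominator never vanishes, since \<open>x\<close> and \<open>1 - x\<close> cannot
  both be nonpositive. Writing \<open>- 1 * x + 1\<close> matches
  \<open>times_differentiable_affine\<close>.\<close>

definition smooth_step :: "real \<Rightarrow> real" where
  "smooth_step x = flat 1 x * inverse (flat 1 x + flat 1 (- 1 * x + 1))"

lemma flat_sum_pos: "flat 1 x + flat 1 (- 1 * x + 1) > 0"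
  by (cases "x > 0"; cases "x < 1") (auto simp: flat_def intro: add_pos_pos)

lemma times_differentiable_smooth_step: "times_differentiable n smooth_step"
  unfolding smooth_step_def[abs_def]
  by (intro times_differentiable_mult times_differentiable_flat times_differentiable_inverse
      times_differentiable_add times_differentiable_affine less_imp_neq[THEN not_sym] flat_sum_pos)

lemma smooth_step_eq_0: "x \<le> 0 \<Longrightarrow> smooth_step x = 0"
  by (simp add: smooth_step_def flat_def)

lemma smooth_step_eq_1: "x \<ge> 1 \<Longrightarrow> smooth_step x = 1"
  by (simp add: smooth_step_def flat_def)

lemma smooth_step_bounds: "0 \<le> smooth_step x" "smooth_step x \<le> 1"
proof -
  have "flat 1 y \<ge> 0" for y by (simp add: flat_def)
  then have *: "0 \<le> flat 1 x \<and> flat 1 x \<le> flat 1 x + flat 1 (- 1 * x + 1)" by simp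
  show "0 \<le> smooth_step x" "smooth_step x \<le> 1"
    using * flat_sum_pos[of x] unfolding smooth_step_def by (auto simp: field_simps)
qed

lemma smooth_step_DERIV: "(smooth_step has_real_derivative deriv smooth_step x) (at x)"
  using times_differentiable_smooth_step times_differentiable_SucE(1) by blast

lemma continuous_on_deriv_smooth_step: "continuous_on X (deriv smooth_step)"
  using times_differentiable_smooth_step[of "Suc (Suc 0)"] 
  by (metis DERIV_continuous_on has_field_derivative_at_within times_differentiable_SucE)

lemma deriv_eq_0_if_const_on_open:
  fixes f :: "real \<Rightarrow> real"
  assumes "open S" "x \<in> S" "\<And>y. y \<in> S \<Longrightarrow> f y = c"
  shows "deriv f x = 0"
proof (rule DERIV_imp_deriv)
  show "(f has_real_derivative 0) (at x)"
    by (rule DERIV_cong_ev[THEN iffD1, OF refl _ refl, of "\<lambda>_. c"])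
      (use assms in \<open>auto intro!: eventually_mono[OF eventually_nhds_in_open[of S]]\<close>)
qed

lemma deriv_smooth_step_eq_0: 
  assumes "x \<notin> {0..1}" shows "deriv smooth_step x = 0"
  using assms deriv_eq_0_if_const_on_open[of "{..<0}" x smooth_step 0]
   deriv_eq_0_if_const_on_open[of "{1<..}" x smooth_step 1]
  by (cases "x < 0") (auto simp: smooth_step_eq_0 smooth_step_eq_1)

text \<open>A smoothed indicator of \<open>{s<..t}\<close>. Both ramps lie to the right of their
  base points, on \<open>{s..s + e}\<close> and \<open>{t..t + e}\<close>; this explains the support
  \<open>{s..t + e}\<close> and the half-open interval in the limit of small
  \<open>e\<close>.\<close>

definition plateau :: "real \<Rightarrow> real \<Rightarrow> real \<Rightarrow> real \<Rightarrow> real" where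
  "plateau s t e x = smooth_step ((x - s) / e) - smooth_step ((x - t) / e)"

lemma plateau_DERIV: 
  "(plateau s t e has_real_derivative deriv smooth_step ((x - s) / e) / e - deriv smooth_step ((x - t) / e) / e) (at x)"
proof -
  have "((\<lambda>x. smooth_step ((x - r) / e)) has_real_derivative deriv smooth_step ((x - r) / e) * (1 / e)) (at x)" for r
    by (rule DERIV_chain2[OF smooth_step_DERIV]) (auto intro!: derivative_eq_intros simp: divide_inverse)
  from DERIV_diff[OF this[of s] this[of t]] show ?thesis
    by (simp add: plateau_def[abs_def])
qed

lemma plateau_eq_0:
  assumes "e > 0" "s \<le> t" "x \<notin> {s..t + e}" shows "plateau s t e x = 0"
  using assms by (cases "x < s") (auto simp: plateau_def smooth_step_eq_0 smooth_step_eq_1 field_simps)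

lemma test_function_plateau:
  assumes "e > 0" "s \<le> t" "{s..t + e} \<subseteq> S"
  shows "test_function_on S (plateau s t e)"
proof -
  have eq: "plateau s t e = (\<lambda>x. smooth_step (inverse e * x + (- s / e)) +
      (-1) * smooth_step (inverse e * x + (- t / e)))"
    using assms(1) by (auto simp: plateau_def fun_eq_iff field_simps)
  have "times_differentiable n (plateau s t e)" for n
    unfolding eq
    by (intro times_differentiable_add times_differentiable_mult times_differentiable_const
         times_differentiable_affine times_differentiable_smooth_step)
  then have "((deriv ^^ n) (plateau s t e)) differentiable (at x)" for n x
    unfolding times_differentiable_def by blast
  then show ?thesis
    unfolding test_function_on_def using assms plateau_eq_0[OF assms(1,2)] compact_Icc by blast
qed

section \<open>The fundamental theorem for weak derivatives\<close>

lemma set_lebesgue_integral_eq_on_support: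
  assumes "K \<subseteq> S" "\<And>x. x \<notin> K \<Longrightarrow> f x = 0"
  shows "(LINT x:S|M. f x) = (LINT x:K|M. f x)"
proof -
  have "indicator S x *\<^sub>R f x = indicator K x *\<^sub>R f x" for x
    using assms by (cases "x \<in> K") auto
  then show ?thesis by (simp only: set_lebesgue_integral_def)
qed

text \<open>The scaled derivative of the step has mass 1 on \<open>{a..a + e}\<close> and size of
  order \<open>1 / e\<close>, so it is a one-sided approximate identity at \<open>a\<close>.\<close>

lemma smooth_step_kernel_tendsto:
  fixes u :: "real \<Rightarrow> real"
  assumes "a < b" "continuous_on {a..b} u"
  shows "((\<lambda>e. integral {a..a + e} (\<lambda>x. u x * (deriv smooth_step ((x - a) / e) / e))) \<longlongrightarrow> u a) (at_right 0)"
proof -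
  have "bounded (deriv smooth_step ` {0..1})"
    using compact_imp_bounded compact_continuous_image continuous_on_deriv_smooth_step compact_Icc by blast
  then obtain M where M: "M > 0" "\<And>x. x \<in> {0..1} \<Longrightarrow> \<bar>deriv smooth_step x\<bar> \<le> M"
    by (auto simp: bounded_pos)
  show ?thesis
  proof (rule tendstoI)
    fix r :: real assume r: "r > 0"
    from assms have "(u \<longlongrightarrow> u a) (at_right a)"
      by (simp add: continuous_on_Icc_at_rightD)
    \<comment> \<open>The kernel is bounded by \<open>M / e\<close> on an interval of length
      \<open>e\<close>, so this tolerance yields the total error \<open>r / 2\<close>.\<close>
    then have "eventually (\<lambda>x. dist (u x) (u a) < r / (2 * M)) (at_right a)"
      using r M(1) by (intro tendstoD) auto
    then obtain c where c: "c > a" "\<And>x. a < x \<Longrightarrow> x < c \<Longrightarrow> \<bar>u x - u a\<bar> < r / (2 * M)"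
      unfolding eventually_at_right_field dist_real_def by blast
    have "dist (integral {a..a + e} (\<lambda>x. u x * (deriv smooth_step ((x - a) / e) / e))) (u a) < r"
      if e: "0 < e" "e < min (c - a) (b - a)" for e
    proof -
      let ?k = "\<lambda>x. deriv smooth_step ((x - a) / e) / e"
      have k: "(?k has_integral 1) {a..a + e}"
      proof -
        have "(?k has_integral smooth_step ((a + e - a) / e) - smooth_step ((a - a) / e)) {a..a + e}"
        proof (rule fundamental_theorem_of_calculus)
          fix x
          have "((\<lambda>x. smooth_step ((x - a) / e)) has_real_derivative deriv smooth_step ((x - a) / e) * (1 / e)) (at x)"
            by (rule DERIV_chain2[OF smooth_step_DERIV]) (auto intro!: derivative_eq_intros simp: divide_inverse)
          then show "((\<lambda>x. smooth_step ((x - a) / e)) has_vector_derivative ?k x) (at x within {a..a + e})"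
            by (simp add: has_real_derivative_iff_has_vector_derivative has_vector_derivative_at_within)
        qed (use e in auto)
        then show ?thesis using e by (simp add: smooth_step_eq_0 smooth_step_eq_1)
      qed
      have kc: "continuous_on {a..a + e} ?k"
        using e by (intro continuous_intros continuous_on_compose2[OF continuous_on_deriv_smooth_step]) auto
      have uc: "continuous_on {a..a + e} u"
        using assms(2) by (rule continuous_on_subset) (use e in auto)
      have "(\<lambda>x. u x * ?k x) integrable_on {a..a + e}"
        by (intro integrable_continuous_interval continuous_on_mult uc kc)
      from has_integral_diff[OF integrable_integral[OF this] has_integral_mult_right[OF k, of "u a"]]
      have h: "((\<lambda>x. (u x - u a) * ?k x) has_integral integral {a..a + e} (\<lambda>x. u x * ?k x) - u a) {a..a + e}"
        by (simp only: left_diff_distrib mult_1_right)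
      have "norm (integral {a..a + e} (\<lambda>x. u x * ?k x) - u a) \<le> (r / (2 * M) * (M / e)) * measure lborel (cbox a (a + e))"
      proof (rule has_integral_bound[where f = "\<lambda>x. (u x - u a) * ?k x"])
        show "((\<lambda>x. (u x - u a) * ?k x) has_integral integral {a..a + e} (\<lambda>x. u x * ?k x) - u a) (cbox a (a + e))"
          using h by simp
        fix x assume x: "x \<in> cbox a (a + e)"
        then have "\<bar>?k x\<bar> \<le> M / e"
          using e M(2)[of "(x - a) / e"] by (auto simp: divide_right_mono)
        moreover have "\<bar>u x - u a\<bar> \<le> r / (2 * M)"
          using c(2)[of x] x e r M(1) by (cases "x = a") auto
        ultimately show "norm ((u x - u a) * ?k x) \<le> r / (2 * M) * (M / e)"
          unfolding real_norm_def abs_mult by (intro mult_mono) (use r M in auto)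
      qed (use r M e in auto)
      also have "\<dots> = r / 2" using e M by simp
      finally show ?thesis using r by (simp add: dist_real_def)
    qed
    moreover have "min (c - a) (b - a) > 0" using c assms by auto
    ultimately show "eventually (\<lambda>e. dist (integral {a..a + e} (\<lambda>x. u x * (deriv smooth_step ((x - a) / e) / e))) (u a) < r) (at_right 0)"
      unfolding eventually_at_right_field by blast
  qed
qed

text \<open>Testing with \<open>plateau s t e\<close> turns one side into a difference of kernel
  averages of \<open>u\<close> near \<open>s\<close> and \<open>t\<close>, and the other into a
  smoothed integral of \<open>v\<close> over \<open>{s<..t}\<close>; then \<open>e\<close> tends to
  0. The gap between \<open>t\<close> and \<open>t'\<close> leaves room for the descending
  ramp.\<close>

lemma weak_deriv_on_FTC:
  assumes w: "weak_deriv_on S u v" and u: "continuous_on S u"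
    and st: "s \<le> t" "t < t'" "{s..t'} \<subseteq> S"
  shows "(v has_integral (u t - u s)) {s..t}"
proof -
  define e where "e n = (t' - t) / real (n + 2)" for n
  have e: "0 < e n" "t + e n \<le> t'" "{s..t + e n} \<subseteq> S" for n
  proof -
    show "0 < e n" using st by (simp add: e_def)
    have "e n \<le> (t' - t) / 1" unfolding e_def by (rule divide_left_mono) (use st in auto)
    then show "t + e n \<le> t'" by simp
    then show "{s..t + e n} \<subseteq> S" using st by auto
  qed
  have "e \<longlonglongrightarrow> 0"
    unfolding e_def using LIMSEQ_ignore_initial_segment[OF lim_const_over_n[of "t' - t"], of 2] by simp
  then have e0: "filterlim e (at_right 0) sequentially"
    using e(1) by (auto simp: filterlim_at less_imp_neq[THEN not_sym])
  define I where "I a e = integral {a..a + e} (\<lambda>x. u x * (deriv smooth_step ((x - a) / e) / e))" for a e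
  have I: "(\<lambda>n. I a (e n)) \<longlonglongrightarrow> u a" if "a = s \<or> a = t" for a
  proof -
    have "a < t'" "{a..t'} \<subseteq> S" using that st by auto
    then have "((\<lambda>e. I a e) \<longlongrightarrow> u a) (at_right 0)"
      unfolding I_def by (intro smooth_step_kernel_tendsto continuous_on_subset[OF u])
    then show ?thesis by (rule filterlim_compose[OF _ e0])
  qed
  have vint: "v absolutely_integrable_on {s..t'}"
    using w st by (auto simp: weak_deriv_on_def)
  have vst: "v integrable_on {s..t}"
    using vint st integrable_on_subinterval[of v "{s..t'}" s t] by (auto simp: absolutely_integrable_on_def)
  have prod: "(\<lambda>x. v x * plateau s t (e n) x) absolutely_integrable_on {s..t'}" for n
  proof -
    have "(\<lambda>x. plateau s t (e n) x * v x) absolutely_integrable_on {s..t'}"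
    proof (rule absolutely_integrable_bounded_measurable_product_real[OF _ _ _ vint])
      have "continuous_on {s..t'} (plateau s t (e n))"
        by (rule DERIV_continuous_on[OF has_field_derivative_at_within[OF plateau_DERIV]])
      then show "plateau s t (e n) \<in> borel_measurable (lebesgue_on {s..t'})" "bounded (plateau s t (e n) ` {s..t'})"
        by (auto intro: continuous_imp_measurable_on_sets_lebesgue compact_imp_bounded compact_continuous_image)
    qed auto
    then show ?thesis by (simp add: mult.commute)
  qed
  \<comment> \<open>The derivative of the plateau is the kernel at \<open>s\<close> minus the kernel
    at \<open>t\<close>; the minus sign in the definition of the weak derivative reverses this
    order.\<close>
  have main: "integral {s..t'} (\<lambda>x. v x * plateau s t (e n) x) = I t (e n) - I s (e n)" for n
  proof -
    let ?\<phi> = "plateau s t (e n)"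
    have d: "deriv ?\<phi> x = deriv smooth_step ((x - s) / e n) / e n - deriv smooth_step ((x - t) / e n) / e n" for x
      by (rule DERIV_imp_deriv[OF plateau_DERIV])
    have h: "((\<lambda>x. u x * (deriv smooth_step ((x - a) / e n) / e n)) has_integral I a (e n)) {s..t'}"
      if "a = s \<or> a = t" for a
    proof (rule has_integral_on_superset)
      show "((\<lambda>x. u x * (deriv smooth_step ((x - a) / e n) / e n)) has_integral I a (e n)) {a..a + e n}"
        unfolding I_def
        using e(1,2)[of n] that st
        by (intro integrable_integral integrable_continuous_interval continuous_intros
            continuous_on_compose2[OF continuous_on_deriv_smooth_step] continuous_on_subset[OF u]) auto
      show "u x * (deriv smooth_step ((x - a) / e n) / e n) = 0" if "x \<notin> {a..a + e n}" for x
        using that e(1)[of n] by (simp add: deriv_smooth_step_eq_0 field_simps)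
      show "{a..a + e n} \<subseteq> {s..t'}" using e(1,2)[of n] that st by auto
    qed
    have h': "((\<lambda>x. u x * deriv ?\<phi> x) has_integral I s (e n) - I t (e n)) {s..t'}"
      using has_integral_diff[OF h h, of s t] by (simp add: d algebra_simps)
    have "continuous_on {s..t'} (\<lambda>x. u x * deriv ?\<phi> x)"
      unfolding d using e(1)[of n] st
      by (intro continuous_intros
            continuous_on_compose2[OF continuous_on_deriv_smooth_step] continuous_on_subset[OF u]) auto
    then have "(LINT x:{s..t'}|lebesgue. u x * deriv ?\<phi> x) = I s (e n) - I t (e n)"
      using absolutely_integrable_continuous_real set_lebesgue_integral_eq_integral(2) integral_unique[OF h']
      by metis
    moreover have zero: "deriv ?\<phi> x = 0" "?\<phi> x = 0" if "x \<notin> {s..t'}" for x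
      using that e(1,2)[of n] st plateau_eq_0[of "e n" s t x]
      by (auto simp: d deriv_smooth_step_eq_0 field_simps)
    have "(LINT x:S|lebesgue. u x * deriv ?\<phi> x) = (LINT x:{s..t'}|lebesgue. u x * deriv ?\<phi> x)"
      "(LINT x:S|lebesgue. v x * ?\<phi> x) = (LINT x:{s..t'}|lebesgue. v x * ?\<phi> x)"
      using st(3) zero by (auto intro!: set_lebesgue_integral_eq_on_support)
    moreover have "(LINT x:S|lebesgue. u x * deriv ?\<phi> x) = - (LINT x:S|lebesgue. v x * ?\<phi> x)"
      using w test_function_plateau[OF e(1) st(1) e(3)] unfolding weak_deriv_on_def by blast
    moreover have "(LINT x:{s..t'}|lebesgue. v x * ?\<phi> x) = integral {s..t'} (\<lambda>x. v x * ?\<phi> x)"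
      by (rule set_lebesgue_integral_eq_integral(2)[OF prod])
    ultimately show ?thesis by simp
  qed
  have "(\<lambda>n. integral {s..t'} (\<lambda>x. v x * plateau s t (e n) x))
      \<longlonglongrightarrow> integral {s..t'} (\<lambda>x. v x * indicator {s<..t} x)"
  proof (rule dominated_convergence(2))
    show "(\<lambda>x. v x * plateau s t (e n) x) integrable_on {s..t'}" for n
      by (rule set_lebesgue_integral_eq_integral(1)[OF prod])
    show "(\<lambda>x. \<bar>v x\<bar>) integrable_on {s..t'}"
      using vint by (simp add: absolutely_integrable_on_def)
    show "norm (v x * plateau s t (e n) x) \<le> \<bar>v x\<bar>" for n x
    proof -
      have "\<bar>plateau s t (e n) x\<bar> \<le> 1"
        using smooth_step_bounds[of "(x - s) / e n"] smooth_step_bounds[of "(x - t) / e n"]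
        by (simp add: plateau_def abs_le_iff)
      then show ?thesis by (simp add: abs_mult mult_left_le)
    qed
    show "(\<lambda>n. v x * plateau s t (e n) x) \<longlonglongrightarrow> v x * indicator {s<..t} x" for x
    proof (intro tendsto_mult tendsto_const)
      \<comment> \<open>At a fixed point each ramp eventually equals its limit exactly: it is 0 for
        \<open>x \<le> a\<close>, and 1 once \<open>e n < x - a\<close>.\<close>
      have ev: "eventually (\<lambda>n. smooth_step ((x - a) / e n) = (if x \<le> a then 0 else 1)) sequentially" for a
      proof (cases "x \<le> a")
        case True
        then show ?thesis using e(1)
          by (simp add: smooth_step_eq_0 divide_nonpos_pos)
      next
        case False
        then have "eventually (\<lambda>n. e n < x - a) sequentially"
          using \<open>e \<longlonglongrightarrow> 0\<close> by (intro order_tendstoD) auto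
        then show ?thesis
          by eventually_elim (use False e(1) in \<open>auto intro!: smooth_step_eq_1 simp: field_simps less_imp_le\<close>)
      qed
      show "(\<lambda>n. plateau s t (e n) x) \<longlonglongrightarrow> indicator {s<..t} x"
        using ev[of s] ev[of t] by (intro tendsto_eventually, eventually_elim) (use st in \<open>auto simp: plateau_def\<close>)
    qed
  qed
  moreover have "(\<lambda>n. integral {s..t'} (\<lambda>x. v x * plateau s t (e n) x)) \<longlonglongrightarrow> u t - u s"
    unfolding main by (intro tendsto_diff I) auto
  ultimately have "integral {s..t'} (\<lambda>x. v x * indicator {s<..t} x) = u t - u s"
    using LIMSEQ_unique by blast
  moreover have "integral {s..t'} (\<lambda>x. v x * indicator {s<..t} x) = integral {s..t'} (\<lambda>x. if x \<in> {s..t} then v x else 0)"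
    by (rule integral_spike[of "{s}"]) (auto simp: indicator_def)
  moreover from vst have "integral {s..t'} (\<lambda>x. if x \<in> {s..t} then v x else 0) = integral {s..t} v"
    using st by (intro integral_unique) (subst has_integral_restrict, auto)
  ultimately show ?thesis
    using vst by (simp add: has_integral_iff)
qed

text \<open>Lebesgue differentiation: almost every \<open>w x\<close> is a limit of averages over
  \<open>{x..x + h}\<close>, all of which vanish. This serves to identify two weak derivatives of
  one function.\<close>

lemma negligible_nonzero_of_integrals_eq_0:
  fixes w :: "real \<Rightarrow> real"
  assumes "\<And>s t. a \<le> s \<Longrightarrow> s \<le> t \<Longrightarrow> (w has_integral 0) {s..t}"
  shows "negligible {x. a \<le> x \<and> w x \<noteq> 0}"
proof -
  \<comment> \<open>Extension by zero to the left of \<open>a\<close> makes the function integrable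
    on every interval, as the differentiation theorem requires.\<close>
  define F where "F x = (if a \<le> x then w x else 0)" for x
  have "F integrable_on cbox p q" for p q
  proof (cases "p \<le> q \<and> a \<le> q")
    case True
    have "(F has_integral 0) {max a p..q}"
      by (rule has_integral_eq[OF _ assms[of "max a p" q]]) (use True in \<open>auto simp: F_def\<close>)
    moreover have "(F has_integral 0) {p..max a p}"
      by (rule has_integral_spike[of "{max a p}", OF _ _ has_integral_0]) (auto simp: F_def)
    ultimately show ?thesis
      using True has_integral_combine[of p "max a p" q F 0 0] by (auto simp: integrable_on_def)
  next
    case False
    have "(F has_integral 0) {p..q}"
      by (rule has_integral_eq[OF _ has_integral_0]) (use False in \<open>auto simp: F_def\<close>)
    then show ?thesis by (auto simp: integrable_on_def)
  qed
  then obtain N where N: "negligible N"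
    "\<And>x e. x \<notin> N \<Longrightarrow> 0 < e \<Longrightarrow> \<exists>d>0. \<forall>h. 0 < h \<and> h < d \<longrightarrow>
        norm (integral (cbox x (x + h *\<^sub>R One)) F /\<^sub>R h ^ DIM(real) - F x) < e"
    using integrable_ccontinuous_explicit by blast
  have "w x = 0" if x: "x \<notin> N" "a \<le> x" for x
  proof (rule ccontr)
    assume "w x \<noteq> 0"
    then obtain d where d: "d > 0" "\<And>h. 0 < h \<Longrightarrow> h < d \<Longrightarrow>
        norm (integral (cbox x (x + h *\<^sub>R One)) F /\<^sub>R h ^ DIM(real) - F x) < \<bar>w x\<bar>"
      using N(2)[OF x(1), of "\<bar>w x\<bar>"] by auto
    have "(F has_integral 0) {x..x + d / 2}"
      by (rule has_integral_eq[OF _ assms]) (use x d in \<open>auto simp: F_def\<close>)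
    then show False
      using d(2)[of "d / 2"] d(1) x(2) by (simp add: integral_unique F_def)
  qed
  then show ?thesis
    using N(1) by (auto elim!: negligible_subset)
qed

text \<open>On a short interval \<open>g (y x)\<close> is almost constant, so the defect
  \<open>E s t\<close> is at most \<open>\<eta>\<close> times the integral of
  \<open>\<bar>z\<bar>\<close>. Defect and bound are both additive over adjacent intervals, so
  bisection carries the estimate to \<open>{a..b}\<close>; finally \<open>\<eta>\<close> is
  arbitrary.\<close>

lemma has_integral_chain_rule:
  fixes y z g G :: "real \<Rightarrow> real"
  assumes "a \<le> b" and y: "continuous_on {a..b} y"
    and zint: "z absolutely_integrable_on {a..b}"
    and yz: "\<And>s t. a \<le> s \<Longrightarrow> s \<le> t \<Longrightarrow> t \<le> b \<Longrightarrow> (z has_integral y t - y s) {s..t}"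
    and G: "\<And>x. (G has_real_derivative g x) (at x)" and g: "continuous_on UNIV g"
  shows "((\<lambda>x. g (y x) * z x) has_integral (G (y b) - G (y a))) {a..b}"
proof -
  let ?h = "\<lambda>x. g (y x) * z x"
  have gy: "continuous_on {a..b} (\<lambda>x. g (y x))"
    using continuous_on_compose2[OF g y] by simp
  have "?h absolutely_integrable_on {a..b}"
    by (rule absolutely_integrable_bounded_measurable_product_real[OF _ _ _ zint])
      (use gy in \<open>auto intro: continuous_imp_measurable_on_sets_lebesgue
          compact_imp_bounded compact_continuous_image\<close>)
  then have hI: "?h integrable_on {s..t}" if "a \<le> s" "t \<le> b" for s t
    using that integrable_on_subinterval[of ?h "{a..b}" s t] by (auto simp: absolutely_integrable_on_def)
  have zI: "(\<lambda>x. \<bar>z x\<bar>) integrable_on {s..t}" if "a \<le> s" "t \<le> b" for s t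
    using zint that integrable_on_subinterval[of "\<lambda>x. \<bar>z x\<bar>" "{a..b}" s t]
    by (auto simp: absolutely_integrable_on_def)
  define E where "E s t = G (y t) - G (y s) - integral {s..t} ?h" for s t
  have small: "\<bar>E a b\<bar> \<le> \<eta> * integral {a..b} (\<lambda>x. \<bar>z x\<bar>)" if "\<eta> > 0" for \<eta>
  proof -
    have "a \<le> a \<longrightarrow> b \<le> b \<longrightarrow> a \<le> b \<longrightarrow> \<bar>E a b\<bar> \<le> \<eta> * integral {a..b} (\<lambda>x. \<bar>z x\<bar>)"
      using \<open>a \<le> b\<close>
    proof (induction rule: Bolzano[where P = "\<lambda>s t. a \<le> s \<longrightarrow> t \<le> b \<longrightarrow> s \<le> t \<longrightarrow>
          \<bar>E s t\<bar> \<le> \<eta> * integral {s..t} (\<lambda>x. \<bar>z x\<bar>)"])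
      case (trans r s t)
      show ?case
      proof (intro impI)
        assume st: "a \<le> r" "t \<le> b" "r \<le> t"
        have "E r t = E r s + E s t"
          using Henstock_Kurzweil_Integration.integral_combine[OF trans(3,4) hI[OF st(1,2)]]
          by (simp add: E_def)
        moreover have "integral {r..t} (\<lambda>x. \<bar>z x\<bar>) = integral {r..s} (\<lambda>x. \<bar>z x\<bar>) + integral {s..t} (\<lambda>x. \<bar>z x\<bar>)"
          using Henstock_Kurzweil_Integration.integral_combine[OF trans(3,4) zI[OF st(1,2)]] by simp
        ultimately show "\<bar>E r t\<bar> \<le> \<eta> * integral {r..t} (\<lambda>x. \<bar>z x\<bar>)"
          using trans st by (simp add: distrib_left)
      qed
    next
      case (local x)
      have "(g \<longlongrightarrow> g (y x)) (nhds (y x))"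
        using g by (simp add: continuous_on_eq_continuous_at isCont_def tendsto_at_iff_tendsto_nhds)
      then have "eventually (\<lambda>u. \<bar>g u - g (y x)\<bar> < \<eta> / 2) (nhds (y x))"
        using tendstoD[of g "g (y x)" _ "\<eta> / 2"] \<open>\<eta> > 0\<close> by (simp add: dist_real_def)
      then obtain \<rho> where \<rho>: "\<rho> > 0" "\<And>u. \<bar>u - y x\<bar> < \<rho> \<Longrightarrow> \<bar>g u - g (y x)\<bar> < \<eta> / 2"
        by (auto simp: eventually_nhds_metric dist_real_def)
      obtain d where d: "d > 0" "\<And>r. r \<in> {a..b} \<Longrightarrow> \<bar>r - x\<bar> < d \<Longrightarrow> \<bar>y r - y x\<bar> < \<rho>"
        using y local \<rho>(1) unfolding continuous_on_iff dist_real_def by force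
      show ?case
      proof (intro exI[of _ d] conjI allI impI)
        fix s t assume st: "s \<le> x \<and> x \<le> t \<and> t - s < d" "a \<le> s" "t \<le> b" "s \<le> t"
        have close: "\<bar>g u - g (y x)\<bar> < \<eta> / 2" if "u \<in> closed_segment (y s) (y t)" for u
          using that d(2)[of s] d(2)[of t] st
          by (intro \<rho>) (auto simp: closed_segment_eq_real_ivl split: if_splits)
        have zst: "(z has_integral y t - y s) {s..t}"
          using yz st by simp
        \<comment> \<open>Both terms of the defect are compared with
          \<open>g (y x) * (y t - y s)\<close>. The mean value bound for
          \<open>G u - g (y x) * u\<close> costs one half of \<open>\<eta>\<close>, the integral of
          \<open>(g (y r) - g (y x)) * z r\<close> the other half.\<close>
        have "\<bar>(G (y t) - g (y x) * y t) - (G (y s) - g (y x) * y s)\<bar> \<le> \<eta> / 2 * \<bar>y t - y s\<bar>"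
          unfolding real_norm_def[symmetric]
        proof (rule field_differentiable_bound[where S = "closed_segment (y s) (y t)"
              and f' = "\<lambda>u. g u - g (y x)"])
          fix u assume u: "u \<in> closed_segment (y s) (y t)"
          show "((\<lambda>u. G u - g (y x) * u) has_real_derivative g u - g (y x)) (at u within closed_segment (y s) (y t))"
            by (rule has_field_derivative_at_within) (auto intro!: derivative_eq_intros G)
          show "norm (g u - g (y x)) \<le> \<eta> / 2"
            using close[OF u] by simp
        qed auto
        also have "\<dots> \<le> \<eta> / 2 * integral {s..t} (\<lambda>x. \<bar>z x\<bar>)"
        proof (rule mult_left_mono)
          have "norm (integral {s..t} z) \<le> integral {s..t} (\<lambda>x. \<bar>z x\<bar>)"
            using zst zI st by (intro integral_norm_bound_integral) (auto simp: has_integral_iff)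
          then show "\<bar>y t - y s\<bar> \<le> integral {s..t} (\<lambda>x. \<bar>z x\<bar>)"
            using zst by (simp add: integral_unique)
        qed (use \<open>\<eta> > 0\<close> in simp)
        finally have 1: "\<bar>G (y t) - G (y s) - g (y x) * (y t - y s)\<bar> \<le> \<eta> / 2 * integral {s..t} (\<lambda>x. \<bar>z x\<bar>)"
          by (simp add: algebra_simps)
        have D: "((\<lambda>r. (g (y r) - g (y x)) * z r) has_integral integral {s..t} ?h - g (y x) * (y t - y s)) {s..t}"
          using has_integral_diff[OF integrable_integral[OF hI[OF st(2,3)]] has_integral_mult_right[OF zst, of "g (y x)"]]
          by (simp add: left_diff_distrib)
        have "norm (integral {s..t} (\<lambda>r. (g (y r) - g (y x)) * z r)) \<le> integral {s..t} (\<lambda>x. \<eta> / 2 * \<bar>z x\<bar>)"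
        proof (rule integral_norm_bound_integral)
          show "(\<lambda>r. (g (y r) - g (y x)) * z r) integrable_on {s..t}" using D by blast
          show "(\<lambda>x. \<eta> / 2 * \<bar>z x\<bar>) integrable_on {s..t}"
            using integrable_on_cmult_left[OF zI[OF st(2,3)], of "\<eta> / 2"] by simp
          fix r assume r: "r \<in> {s..t}"
          have "\<bar>g (y r) - g (y x)\<bar> \<le> \<eta> / 2"
            using r st by (intro less_imp_le \<rho> d) auto
          then show "norm ((g (y r) - g (y x)) * z r) \<le> \<eta> / 2 * \<bar>z r\<bar>"
            unfolding real_norm_def abs_mult by (rule mult_right_mono) simp
        qed
        then have "\<bar>integral {s..t} ?h - g (y x) * (y t - y s)\<bar> \<le> \<eta> / 2 * integral {s..t} (\<lambda>x. \<bar>z x\<bar>)"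
          using D by (simp add: integral_unique)
        with 1 show "\<bar>E s t\<bar> \<le> \<eta> * integral {s..t} (\<lambda>x. \<bar>z x\<bar>)"
          unfolding E_def by linarith
      qed (rule d)
    qed
    then show ?thesis using \<open>a \<le> b\<close> by simp
  qed
  have "\<bar>E a b\<bar> \<le> 0"
  proof (rule field_le_epsilon)
    fix r :: real assume "r > 0"
    let ?B = "integral {a..b} (\<lambda>x. \<bar>z x\<bar>)"
    have B: "?B \<ge> 0" by (rule integral_nonneg) (use zI in auto)
    \<comment> \<open>Adding 1 avoids a division by zero when \<open>?B = 0\<close>.\<close>
    have "\<bar>E a b\<bar> \<le> r / (?B + 1) * ?B"
      using small[of "r / (?B + 1)"] B \<open>r > 0\<close> by simp
    also have "\<dots> \<le> r" using B \<open>r > 0\<close> by (simp add: field_simps)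
    finally show "\<bar>E a b\<bar> \<le> 0 + r" by simp
  qed
  then show ?thesis
    using integrable_integral[OF hI[of a b]] by (simp add: E_def)
qed

section \<open>The energy of a neutral equation\<close>

text \<open>Here \<open>z\<close> plays the role of \<open>y'\<close>. The antiderivative
  \<open>G\<close> is determined only up to a constant, which permits a shift to a nonnegative
  potential where one is wanted.\<close>

locale neutral_energy =
  fixes c :: real and y z g G :: "real \<Rightarrow> real" and N :: "real set"
  assumes c: "c \<in> {-1, 1}"
    and y_cont: "continuous_on {0..} y"
    and z_int: "\<And>s t. 0 \<le> s \<Longrightarrow> s \<le> t \<Longrightarrow> (z has_integral y t - y s) {s..t}"
    and z_abs: "\<And>s t. 0 \<le> s \<Longrightarrow> s \<le> t \<Longrightarrow> z absolutely_integrable_on {s..t}"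
    and z_sq: "\<And>s t. 0 \<le> s \<Longrightarrow> s \<le> t \<Longrightarrow> (\<lambda>x. (z x)\<^sup>2) integrable_on {s..t}"
    and N: "negligible N"
    and eqn: "\<And>t. 1 < t \<Longrightarrow> t \<notin> N \<Longrightarrow> z t + c * z (t - 1) + g (y t) = 0"
    and G: "\<And>x. (G has_real_derivative g x) (at x)"
    and g: "continuous_on UNIV g"
begin

definition energy :: "real \<Rightarrow> real" where
  "energy t = integral {t - 1..t} (\<lambda>x. (z x)\<^sup>2) + 2 * G (y t)"

definition dissipation :: "real \<Rightarrow> real" where
  "dissipation t = integral {1..t} (\<lambda>x. (g (y x))\<^sup>2)"

lemma gy_cont: "0 \<le> s \<Longrightarrow> continuous_on {s..t} (\<lambda>x. g (y x))"
  by (rule continuous_on_compose2[OF g continuous_on_subset[OF y_cont]]) auto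

lemma gy_sq_int: "0 \<le> s \<Longrightarrow> (\<lambda>x. (g (y x))\<^sup>2) integrable_on {s..t}"
  by (intro integrable_continuous_interval continuous_on_power gy_cont)

lemma dissipation_diff:
  assumes "1 \<le> s" "s \<le> t"
  shows "dissipation t - dissipation s = integral {s..t} (\<lambda>x. (g (y x))\<^sup>2)"
  using Henstock_Kurzweil_Integration.integral_combine[OF assms gy_sq_int[of 1 t]]
  by (simp add: dissipation_def)

lemma dissipation_ge:
  assumes "1 \<le> s" "s \<le> t" "\<And>x. s \<le> x \<Longrightarrow> x \<le> t \<Longrightarrow> m \<le> (g (y x))\<^sup>2"
  shows "m * (t - s) \<le> dissipation t - dissipation s"
proof -
  have "integral {s..t} (\<lambda>x. m) \<le> integral {s..t} (\<lambda>x. (g (y x))\<^sup>2)"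
    by (rule integral_le) (use assms gy_sq_int in auto)
  then show ?thesis using assms by (simp add: dissipation_diff mult.commute)
qed

lemma dissipation_mono: "1 \<le> s \<Longrightarrow> s \<le> t \<Longrightarrow> dissipation s \<le> dissipation t"
  using dissipation_ge[of s t 0] by simp

lemma dissipation_nonneg: "1 \<le> t \<Longrightarrow> 0 \<le> dissipation t"
  using dissipation_mono[of 1 t] by (simp add: dissipation_def)

text \<open>The identity \<open>(z x + g (y x))\<^sup>2 = (z (x - 1))\<^sup>2\<close>, from
  \<open>c\<^sup>2 = 1\<close>, is integrated over \<open>{1..t}\<close>. The cross term is
  evaluated by the chain rule, and the delayed term becomes an integral over
  \<open>{0..t - 1}\<close>.\<close>

lemma energy_balance:
  assumes "1 \<le> t"
  shows "energy t + dissipation t = energy 1"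
proof -
  let ?q = "\<lambda>x. (z x)\<^sup>2"
  have "((\<lambda>x. ?q x + 2 * (g (y x) * z x) + (g (y x))\<^sup>2) has_integral
      integral {1..t} ?q + 2 * (G (y t) - G (y 1)) + dissipation t) {1..t}"
    unfolding dissipation_def
    using assms
    by (intro has_integral_add has_integral_mult_right has_integral_chain_rule integrable_integral
        z_sq gy_sq_int z_abs z_int G g continuous_on_subset[OF y_cont]) auto
  moreover have "((\<lambda>x. ?q x + 2 * (g (y x) * z x) + (g (y x))\<^sup>2) has_integral
      integral {0..t - 1} ?q) {1..t}"
  \<comment> \<open>The point 1 joins the exceptional set because the equation is available only for
    times strictly greater than 1.\<close>
  proof (rule has_integral_spike[where S = "insert 1 N"])
    show "((\<lambda>x. ?q (x + - 1)) has_integral integral {0..t - 1} ?q) {1..t}"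
      using has_integral_shift_real_ivl[OF integrable_integral[OF z_sq[of 0 "t - 1"]], of "-1"] assms
      by simp
    show "negligible (insert 1 N)" using N by simp
    fix x assume "x \<in> {1..t} - insert 1 N"
    then have "z x + g (y x) = - c * z (x - 1)" using eqn[of x] by auto
    then have "(z x + g (y x))\<^sup>2 = ?q (x - 1)" using c by auto
    then show "?q x + 2 * (g (y x) * z x) + (g (y x))\<^sup>2 = ?q (x + - 1)"
      by (simp add: power2_sum algebra_simps)
  qed
  ultimately have "integral {1..t} ?q + 2 * (G (y t) - G (y 1)) + dissipation t = integral {0..t - 1} ?q"
    by (rule has_integral_unique)
  \<comment> \<open>Two splittings of \<open>{0..t}\<close> reduce the difference of the integrals
    to the windows \<open>{0..1}\<close> and \<open>{t - 1..t}\<close> of the energy.\<close>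
  moreover have "integral {0..1} ?q + integral {1..t} ?q = integral {0..t} ?q"
    "integral {0..t - 1} ?q + integral {t - 1..t} ?q = integral {0..t} ?q"
    using assms by (auto intro!: Henstock_Kurzweil_Integration.integral_combine z_sq)
  ultimately show ?thesis by (simp add: energy_def)
qed

section \<open>Asymptotic consequences of the energy balance\<close>

lemma z_sq_nonneg: "0 \<le> s \<Longrightarrow> s \<le> t \<Longrightarrow> 0 \<le> integral {s..t} (\<lambda>x. (z x)\<^sup>2)"
  by (rule integral_nonneg[OF z_sq]) auto

lemma potential_le: "1 \<le> t \<Longrightarrow> 2 * G (y t) + dissipation t \<le> energy 1"
  using energy_balance[of t] z_sq_nonneg[of "t - 1" t] by (simp add: energy_def)

text \<open>Dissipation grows at least like \<open>m * (t - 1)\<close> while \<open>energy 1\<close>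
  is fixed, so the potential has to pay for it.\<close>

lemma potential_at_bot:
  assumes "m > 0" "\<And>x. m \<le> (g x)\<^sup>2"
  shows "filterlim (\<lambda>t. G (y t)) at_bot at_top"
  unfolding filterlim_at_bot eventually_at_top_linorder
proof (intro allI exI impI)
  fix Z t :: real
  assume t: "max 1 ((energy 1 - 2 * Z) / m + 1) \<le> t"
  then have "m * (t - 1) \<le> dissipation t"
    using dissipation_ge[of 1 t m] assms by (simp add: dissipation_def)
  moreover have "(energy 1 - 2 * Z) / m \<le> t - 1" using t by simp
  then have "energy 1 - 2 * Z \<le> m * (t - 1)"
    using assms(1) by (simp add: field_simps)
  ultimately show "G (y t) \<le> Z" using potential_le[of t] t by simp
qed

text \<open>If \<open>g L\<close> were nonzero, dissipation would grow linearly along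
  \<open>y\<close> while \<open>G (y t)\<close> stays near \<open>G L\<close>, exceeding the fixed
  budget \<open>energy 1\<close>.\<close>

lemma limit_imp_root:
  assumes "(y \<longlongrightarrow> L) at_top"
  shows "g L = 0"
proof (rule ccontr)
  assume L: "g L \<noteq> 0"
  have contL: "isCont g L" "isCont G L"
    using g DERIV_isCont[OF G] by (auto simp: continuous_on_eq_continuous_at)
  have "((\<lambda>t. (g (y t))\<^sup>2) \<longlongrightarrow> (g L)\<^sup>2) at_top"
    by (intro tendsto_power isCont_tendsto_compose[OF contL(1)] assms)
  then have "eventually (\<lambda>t. (g L)\<^sup>2 / 2 < (g (y t))\<^sup>2) at_top"
    by (rule order_tendstoD) (use L in simp)
  moreover have "((\<lambda>t. G (y t)) \<longlongrightarrow> G L) at_top"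
    by (intro isCont_tendsto_compose[OF contL(2)] assms)
  then have "eventually (\<lambda>t. G L - 1 < G (y t)) at_top"
    by (rule order_tendstoD) simp
  ultimately have "eventually (\<lambda>t. (g L)\<^sup>2 / 2 < (g (y t))\<^sup>2 \<and> G L - 1 < G (y t) \<and> 1 \<le> t) at_top"
    using eventually_ge_at_top[of 1] by eventually_elim simp
  then obtain T where T: "\<And>t. T \<le> t \<Longrightarrow> (g L)\<^sup>2 / 2 < (g (y t))\<^sup>2 \<and> G L - 1 < G (y t) \<and> 1 \<le> t"
    by (auto simp: eventually_at_top_linorder)
  \<comment> \<open>At the rate \<open>(g L)\<^sup>2 / 2\<close>, this time suffices to dissipate
    everything available above the lower bound \<open>2 * (G L - 1)\<close>.\<close>
  define r where "r = \<bar>energy 1 - 2 * (G L - 1)\<bar> / ((g L)\<^sup>2 / 2)"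
  have "r \<ge> 0" by (simp add: r_def)
  have "(g L)\<^sup>2 / 2 * r \<le> dissipation (T + r) - dissipation T"
    using dissipation_ge[of T "T + r" "(g L)\<^sup>2 / 2"] T \<open>r \<ge> 0\<close> by (auto intro: less_imp_le)
  moreover have "(g L)\<^sup>2 / 2 * r = \<bar>energy 1 - 2 * (G L - 1)\<bar>"
    using L by (simp add: r_def)
  ultimately have "energy 1 - 2 * (G L - 1) \<le> dissipation (T + r) - dissipation T"
    by (metis abs_ge_self order_trans)
  moreover have "2 * G (y (T + r)) + dissipation (T + r) \<le> energy 1" "G L - 1 < G (y (T + r))"
    "0 \<le> dissipation T"
    using T[of "T + r"] T[of T] \<open>r \<ge> 0\<close> potential_le dissipation_nonneg by auto
  ultimately show False by (simp add: algebra_simps)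
qed

text \<open>For \<open>0 \<le> G\<close> the energy bounds the integral of
  \<open>(z x)\<^sup>2\<close> over every unit window ending at \<open>t \<ge> 1\<close>. Young's
  inequality \<open>\<bar>z x\<bar> \<le> l / 2 * (z x)\<^sup>2 + 1 / (2 * l)\<close> converts this
  into a modulus of continuity.\<close>

lemma equicontinuous:
  assumes "\<And>x. 0 \<le> G x" "r > 0"
  shows "\<exists>\<tau>>0. \<forall>s\<ge>1. \<forall>t. s \<le> t \<and> t \<le> s + \<tau> \<longrightarrow> \<bar>y t - y s\<bar> \<le> r"
proof -
  define E where "E = \<bar>energy 1\<bar> + 1"
  \<comment> \<open>With this \<open>l\<close> and \<open>t - s \<le> l * r\<close>, the two terms
    from Young's inequality contribute at most \<open>r / 2\<close> each. The bound 1 in the minimum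
    below keeps \<open>{s..t}\<close> inside \<open>{t - 1..t}\<close>.\<close>
  define l where "l = r / E"
  have pos: "E > 0" "l > 0" using assms(2) by (auto simp: E_def l_def)
  have est: "\<bar>y t - y s\<bar> \<le> r" if st: "1 \<le> s" "s \<le> t" "t \<le> s + min 1 (l * r)" for s t
  proof -
    have "integral {t - 1..s} (\<lambda>x. (z x)\<^sup>2) + integral {s..t} (\<lambda>x. (z x)\<^sup>2) = integral {t - 1..t} (\<lambda>x. (z x)\<^sup>2)"
      using st by (intro Henstock_Kurzweil_Integration.integral_combine z_sq) auto
    moreover have "0 \<le> integral {t - 1..s} (\<lambda>x. (z x)\<^sup>2)"
      using st by (intro z_sq_nonneg) auto
    moreover have "integral {t - 1..t} (\<lambda>x. (z x)\<^sup>2) \<le> E"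
      using st energy_balance[of t] dissipation_nonneg[of t] assms(1)[of "y t"] by (simp add: energy_def E_def)
    ultimately have zE: "integral {s..t} (\<lambda>x. (z x)\<^sup>2) \<le> E" by linarith
    have i: "(\<lambda>x. l / 2 * (z x)\<^sup>2) integrable_on {s..t}" "(\<lambda>x. 1 / (2 * l)) integrable_on {s..t}"
      using integrable_on_cmult_left[OF z_sq[of s t], of "l / 2"] st by auto
    have "norm (integral {s..t} z) \<le> integral {s..t} (\<lambda>x. l / 2 * (z x)\<^sup>2 + 1 / (2 * l))"
    proof (rule integral_norm_bound_integral)
      show "z integrable_on {s..t}" using z_int[of s t] st by auto
      show "(\<lambda>x. l / 2 * (z x)\<^sup>2 + 1 / (2 * l)) integrable_on {s..t}"
        by (rule integrable_add[OF i])
      fix x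
      have "2 * (l * \<bar>z x\<bar>) \<le> (l * \<bar>z x\<bar>)\<^sup>2 + 1"
        using sum_squares_ge_zero[of "l * \<bar>z x\<bar> - 1" 0] by (simp add: algebra_simps power2_eq_square)
      then show "norm (z x) \<le> l / 2 * (z x)\<^sup>2 + 1 / (2 * l)"
        using pos by (simp add: field_simps power2_eq_square)
    qed
    also have "\<dots> = l / 2 * integral {s..t} (\<lambda>x. (z x)\<^sup>2) + (t - s) / (2 * l)"
      using st by (subst Henstock_Kurzweil_Integration.integral_add[OF i]) auto
    also have "\<dots> \<le> l / 2 * E + l * r / (2 * l)"
      using zE st pos by (intro add_mono mult_left_mono divide_right_mono) auto
    also have "\<dots> = r" using pos by (simp add: l_def)
    finally show ?thesis using z_int[of s t] st by (simp add: integral_unique)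
  qed
  show ?thesis
    by (rule exI[of _ "min 1 (l * r)"]) (use est pos assms(2) in auto)
qed

text \<open>An argument of Barbalat type: whenever \<open>y\<close> is \<open>r\<close> away from
  \<open>d\<close>, equicontinuity keeps it at least \<open>r / 2\<close> away for a time
  \<open>\<tau>\<close>, which dissipates at least \<open>m * \<tau>\<close>. Bounded monotone
  dissipation excludes this at late times.\<close>

lemma convergent_to_root:
  assumes "strict_mono g" "g d = 0" "\<And>x. 0 \<le> G x"
  shows "(y \<longlongrightarrow> d) at_top"
proof (rule tendstoI)
  fix r :: real assume r: "r > 0"
  obtain \<tau> where \<tau>: "\<tau> > 0" "\<And>s t. 1 \<le> s \<Longrightarrow> s \<le> t \<Longrightarrow> t \<le> s + \<tau> \<Longrightarrow> \<bar>y t - y s\<bar> \<le> r / 2"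
    using equicontinuous[OF assms(3), of "r / 2"] r by auto
  \<comment> \<open>By monotonicity of \<open>g\<close>, the values at \<open>d + r / 2\<close> and
    \<open>d - r / 2\<close> control \<open>g\<close> outside this neighbourhood of its
    root.\<close>
  define m where "m = min ((g (d + r / 2))\<^sup>2) ((g (d - r / 2))\<^sup>2)"
  have gpos: "0 < g (d + r / 2)" "g (d - r / 2) < 0"
    using strict_monoD[OF assms(1), of d "d + r / 2"] strict_monoD[OF assms(1), of "d - r / 2" d] r assms(2)
    by auto
  then have "m > 0" by (auto simp: m_def)
  have m: "m \<le> (g x)\<^sup>2" if x: "r / 2 \<le> \<bar>x - d\<bar>" for x
  proof -
    have "g (d + r / 2) \<le> g x \<or> g x \<le> g (d - r / 2)"
      using x strict_mono_less_eq[OF assms(1)] by (auto simp: abs_if split: if_splits)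
    then have "\<bar>g (d + r / 2)\<bar> \<le> \<bar>g x\<bar> \<or> \<bar>g (d - r / 2)\<bar> \<le> \<bar>g x\<bar>"
      using gpos by auto
    then show ?thesis by (auto simp: m_def abs_le_square_iff)
  qed
  define J where "J = dissipation ` {1..}"
  have "bdd_above J"
    unfolding J_def
  proof (rule bdd_aboveI2)
    fix t :: real assume "t \<in> {1..}"
    then show "dissipation t \<le> energy 1" using potential_le[of t] assms(3)[of "y t"] by simp
  qed
  moreover have "J \<noteq> {}" by (auto simp: J_def)
  \<comment> \<open>After \<open>T\<close>, less than \<open>m * \<tau>\<close> of the total
    dissipation remains.\<close>
  ultimately obtain T where T: "1 \<le> T" "Sup J - m * \<tau> < dissipation T"
    using less_cSup_iff[of J "Sup J - m * \<tau>"] \<open>m > 0\<close> \<tau>(1) by (auto simp: J_def)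
  have "dist (y t) d < r" if t: "T \<le> t" for t
  proof (rule ccontr)
    assume "\<not> dist (y t) d < r"
    then have far: "r \<le> \<bar>y t - d\<bar>" by (simp add: dist_real_def)
    have "m * (t + \<tau> - t) \<le> dissipation (t + \<tau>) - dissipation t"
    proof (rule dissipation_ge)
      fix x assume "t \<le> x" "x \<le> t + \<tau>"
      then have "\<bar>y x - y t\<bar> \<le> r / 2" using \<tau>(2)[of t x] t T by auto
      then show "m \<le> (g (y x))\<^sup>2" using far by (intro m) linarith
    qed (use t T \<tau> in auto)
    moreover have "dissipation (t + \<tau>) \<le> Sup J"
      using t T \<tau>(1) by (intro cSup_upper \<open>bdd_above J\<close>) (auto simp: J_def)
    moreover have "dissipation T \<le> dissipation t" using t T by (intro dissipation_mono)
    ultimately show False using T by simp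
  qed
  then show "eventually (\<lambda>t. dist (y t) d < r) at_top"
    by (auto simp: eventually_at_top_linorder)
qed

end

section \<open>Solutions of the neutral delay differential equation\<close>

lemma L2_on_const:
  assumes "S \<in> lmeasurable"
  shows "L2_on S (\<lambda>_. a)"
  unfolding L2_on_def set_borel_measurable_def set_integrable_def
  using assms by (auto simp: fmeasurable_def)

text \<open>The point is that the derivative of a test function has integral 0: it vanishes off the
  compact support, so an interval around the support with endpoints outside it suffices.\<close>

lemma weak_deriv_on_const: "weak_deriv_on S (\<lambda>_. a) (\<lambda>_. 0)"
  unfolding weak_deriv_on_def
proof (intro conjI allI impI)
  fix K assume "compact K \<and> K \<subseteq> S"
  then have "K \<in> lmeasurable" by (simp add: lmeasurable_compact)
  then show "(\<lambda>_. a) absolutely_integrable_on K" "(\<lambda>_. 0) absolutely_integrable_on K"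
    by (auto simp: set_integrable_def fmeasurable_def)
next
  fix \<phi> assume \<phi>: "test_function_on S \<phi>"
  then obtain K where K: "compact K" "K \<subseteq> S" "\<And>x. x \<notin> K \<Longrightarrow> \<phi> x = 0"
    by (auto simp: test_function_on_def)
  have "((deriv ^^ 0) \<phi>) differentiable (at x)" "((deriv ^^ Suc 0) \<phi>) differentiable (at x)" for x
    using \<phi> unfolding test_function_on_def by blast+
  then have d: "(\<phi> has_real_derivative deriv \<phi> x) (at x)" "isCont (deriv \<phi>) x" for x
    by (simp_all add: DERIV_deriv_iff_real_differentiable differentiable_imp_continuous_within)
  have d0: "deriv \<phi> x = 0" if "x \<notin> K" for x
    by (rule deriv_eq_0_if_const_on_open[of "- K"]) (use K that compact_imp_closed in auto)
  obtain M where M: "K \<subseteq> {- M..M}"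
    using compact_imp_bounded[OF K(1)] by (force simp: bounded_real abs_le_iff)
  \<comment> \<open>The absolute value covers a negative \<open>M\<close>, possible when
    \<open>K\<close> is empty; the added 1 puts the endpoints outside \<open>K\<close>.\<close>
  let ?J = "{- \<bar>M\<bar> - 1..\<bar>M\<bar> + 1}"
  have "((\<lambda>x. a * deriv \<phi> x) has_integral a * (\<phi> (\<bar>M\<bar> + 1) - \<phi> (- \<bar>M\<bar> - 1))) ?J"
    by (intro has_integral_mult_right fundamental_theorem_of_calculus)
      (auto intro!: has_vector_derivative_at_within d(1)[unfolded has_real_derivative_iff_has_vector_derivative])
  moreover have "\<phi> (\<bar>M\<bar> + 1) = 0" "\<phi> (- \<bar>M\<bar> - 1) = 0"
    by (intro K(3); use M in force)+
  moreover have "(\<lambda>x. a * deriv \<phi> x) absolutely_integrable_on ?J"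
    by (intro absolutely_integrable_continuous_real continuous_intros continuous_at_imp_continuous_on) (use d in auto)
  ultimately have "(LINT x:?J|lebesgue. a * deriv \<phi> x) = 0"
    by (metis set_lebesgue_integral_eq_integral(2) integral_unique diff_self mult_zero_right)
  moreover have "(LINT x:S|lebesgue. a * deriv \<phi> x) = (LINT x:?J|lebesgue. a * deriv \<phi> x)"
  proof -
    have "(LINT x:T|lebesgue. a * deriv \<phi> x) = (LINT x:K|lebesgue. a * deriv \<phi> x)" if "K \<subseteq> T" for T
      using that by (rule set_lebesgue_integral_eq_on_support) (simp add: d0)
    moreover have "K \<subseteq> ?J" using M by force
    ultimately show ?thesis using K(2) by presburger
  qed
  ultimately have "(LINT x:S|lebesgue. a * deriv \<phi> x) = 0"
    by (rule trans[rotated])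
  then show "(LINT x:S|lebesgue. a * deriv \<phi> x) = - (LINT x:S|lebesgue. 0 * \<phi> x)"
    by (simp only: mult_zero_left set_lebesgue_integral_def) simp
qed

lemma H1_on_const: "S \<in> lmeasurable \<Longrightarrow> H1_on S (\<lambda>_. a)"
  unfolding H1_on_def
  by (intro conjI exI[of _ "\<lambda>_. 0"] weak_deriv_on_const L2_on_const continuous_on_const)

lemma H1loc_on_const: "H1loc_on S (\<lambda>_. a)"
  unfolding H1loc_on_def
  by (intro conjI allI impI exI[of _ "\<lambda>_. 0"] weak_deriv_on_const L2_on_const continuous_on_const
      lmeasurable_compact) auto

lemma ndde_solution_const:
  assumes "D = f d"
  shows "ndde_solution c f D (\<lambda>_. d) (\<lambda>_. d)"
  unfolding ndde_solution_def
  by (intro conjI ballI H1loc_on_const exI[of _ "\<lambda>_. 0"] weak_deriv_on_const) (simp_all add: assms)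

text \<open>The energy is used from time \<open>1\<close> on, hence only involves \<open>y'\<close> on \<open>{0..}\<close>, where it is
  square integrable on bounded intervals; near \<open>-1\<close> this does not follow from \<open>H1loc_on\<close>.\<close>

lemma ndde_solution_neutral_energy:
  assumes sol: "ndde_solution c f D y0 y" and c: "c \<in> {-1, 1}" and f: "continuous_on UNIV f"
  shows "\<exists>z N. \<forall>G. (\<forall>x. (G has_real_derivative f x - D) (at x)) \<longrightarrow>
    neutral_energy c y z (\<lambda>x. f x - D) G N"
proof -
  have H: "H1loc_on {-1<..} y"
    using sol unfolding ndde_solution_def by blast
  then obtain z where z: "weak_deriv_on {-1<..} y z"
    "\<And>K. compact K \<Longrightarrow> K \<subseteq> {-1<..} \<Longrightarrow> L2_on K z"
    unfolding H1loc_on_def by blast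
  have y: "continuous_on {-1<..} y" using H unfolding H1loc_on_def by blast
  obtain y' where y': "weak_deriv_on {-1<..} y y'"
    "AE t in lebesgue. 0 < t \<and> t \<notin> \<nat> \<longrightarrow> y' t + c * y' (t - 1) + f (y t) = D"
    using sol unfolding ndde_solution_def by blast
  from y'(2) obtain M where M: "negligible M"
    "\<And>t. t \<notin> M \<Longrightarrow> 0 < t \<Longrightarrow> t \<notin> \<nat> \<Longrightarrow> y' t + c * y' (t - 1) + f (y t) = D"
    unfolding eventually_ae_filter_negligible by blast
  have FTC: "(v has_integral y t - y s) {s..t}" if "weak_deriv_on {-1<..} y v" "0 \<le> s" "s \<le> t" for v s t
    by (rule weak_deriv_on_FTC[OF that(1) y that(3), of "t + 1"]) (use that in auto)
  \<comment> \<open>The derivative \<open>z\<close> from \<open>H1loc_on\<close> is locally square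
    integrable, whereas \<open>y'\<close> satisfies the equation. Both have the same integrals, so
    they differ on a null set only.\<close>
  define P where "P = {t. 0 \<le> t \<and> y' t - z t \<noteq> 0}"
  have P: "negligible P"
    unfolding P_def
  proof (rule negligible_nonzero_of_integrals_eq_0)
    fix s t :: real assume "0 \<le> s" "s \<le> t"
    then show "((\<lambda>t. y' t - z t) has_integral 0) {s..t}"
      using has_integral_diff[OF FTC[OF y'(1)] FTC[OF z(1)], of s t] by simp
  qed
  \<comment> \<open>The translate of \<open>P\<close> by 1 takes care of the delayed argument
    \<open>t - 1\<close>.\<close>
  define N where "N = M \<union> \<nat> \<union> P \<union> (+) 1 ` P"
  have "neutral_energy c y z (\<lambda>x. f x - D) G N" if G: "\<And>x. (G has_real_derivative f x - D) (at x)" for G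
  proof
    show "continuous_on {0..} y" by (rule continuous_on_subset[OF y]) auto
    show "continuous_on UNIV (\<lambda>x. f x - D)" by (intro continuous_intros f)
    have "negligible (\<nat> :: real set)"
      unfolding negligible_iff_null_sets Nats_def
      by (intro null_sets_completionI countable_imp_null_set_lborel) simp
    then show "negligible N"
      using M(1) P negligible_translation[OF P, of 1] by (auto simp: N_def)
    fix s t :: real assume st: "0 \<le> s" "s \<le> t"
    then show "(z has_integral y t - y s) {s..t}" by (rule FTC[OF z(1)])
    have K: "compact {s..t}" "{s..t} \<subseteq> {-1<..}" using st by auto
    show "z absolutely_integrable_on {s..t}" using z(1) K unfolding weak_deriv_on_def by blast
    show "(\<lambda>x. (z x)\<^sup>2) integrable_on {s..t}"
      using z(2)[OF K] set_lebesgue_integral_eq_integral(1) unfolding L2_on_def by blast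
  next
    fix t :: real assume t: "1 < t" "t \<notin> N"
    have "t - 1 \<notin> P" using t(2) by (force simp: N_def image_iff)
    then have "y' t = z t" "y' (t - 1) = z (t - 1)" using t by (auto simp: N_def P_def)
    then show "z t + c * z (t - 1) + (f (y t) - D) = 0"
      using M(2)[of t] t by (auto simp: N_def)
  qed (use c G in auto)
  then show ?thesis by blast
qed

section \<open>The potential and the three cases\<close>

lemma continuous_antiderivative:
  fixes g :: "real \<Rightarrow> real"
  assumes "continuous_on UNIV g"
  obtains G where "\<And>x. (G has_real_derivative g x) (at x)"
  using einterval_antiderivative[of "-\<infinity>" "\<infinity>" g] assms
  by (auto simp: continuous_on_eq_continuous_at has_real_derivative_iff_has_vector_derivative)

text \<open>The sign of \<open>g\<close> changes at \<open>d\<close> from negative to positive.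
  Subtracting \<open>G d\<close> therefore gives the nonnegative potential that
  \<open>convergent_to_root\<close> asks for.\<close>

lemma antiderivative_minimum:
  fixes g G :: "real \<Rightarrow> real"
  assumes "strict_mono g" "g d = 0" "\<And>x. (G has_real_derivative g x) (at x)"
  shows "G d \<le> G x"
proof (cases "d \<le> x")
  case True
  have "0 \<le> g u" if "d \<le> u" for u
    using that assms(2) strict_mono_less_eq[OF assms(1), of d u] by simp
  then show ?thesis
    using assms(3) by (intro DERIV_nonneg_imp_nondecreasing[OF True]) blast
next
  case False
  have "g u \<le> 0" if "u \<le> d" for u
    using that assms(2) strict_mono_less_eq[OF assms(1), of u d] by simp
  then show ?thesis
    using False assms(3) by (intro DERIV_nonpos_imp_nonincreasing[of x d]) auto
qed

theorem corollary1:
  fixes c D :: real and f f' y0 y :: "real \<Rightarrow> real"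
  assumes "c \<in> {-1, 1}"
    and "\<And>x. (f has_real_derivative f' x) (at x)"
    and "continuous_on UNIV f'"
    and "\<And>x. f' x > 0"
    and "f 0 = 0"
    and "H1_on {-1<..<0} y0"
    and "ndde_solution c f D y0 y"
  shows "(D \<in> range f \<or> (SUP x. ereal (f x)) \<le> ereal D \<or> ereal D \<le> (INF x. ereal (f x))) \<and>
    (\<forall>d. D = f d \<longrightarrow>
        globally_attractive c f D d \<and> (\<forall>e. globally_attractive c f D e \<longrightarrow> e = d)) \<and>
    (ereal D > (SUP x. ereal (f x)) \<longrightarrow> filterlim y at_top at_top) \<and>
    (ereal D < (INF x. ereal (f x)) \<longrightarrow> filterlim y at_bot at_top) \<and>
    (ereal D = (SUP x. ereal (f x)) \<or> ereal D = (INF x. ereal (f x)) \<longrightarrow>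
        \<not> (\<exists>L. (y \<longlongrightarrow> L) at_top))"
proof -
  note c = assms(1) and f' = assms(2) and fpos = assms(4) and sol = assms(7)
  have mono: "strict_mono f"
    by (rule strict_monoI, rule DERIV_pos_imp_increasing) (use f' fpos in blast)+
  have cont: "continuous_on UNIV f"
    using DERIV_isCont[OF f'] by (simp add: continuous_on_eq_continuous_at)
  then have cont': "continuous_on UNIV (\<lambda>x. f x - D)" by (intro continuous_intros)
  have mono': "strict_mono (\<lambda>x. f x - D)" using mono by (simp add: strict_mono_def)
  obtain G where G: "\<And>x. (G has_real_derivative f x - D) (at x)"
    using continuous_antiderivative[OF cont'] by blast
  have red: "\<exists>z N. neutral_energy c u z (\<lambda>x. f x - D) H N"
    if "ndde_solution c f D u0 u" "\<And>x. (H has_real_derivative f x - D) (at x)" for u0 u H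
    using ndde_solution_neutral_energy[OF that(1) c cont] that(2) by blast
  obtain z N where "neutral_energy c y z (\<lambda>x. f x - D) G N"
    using red[OF sol G] by blast
  then interpret neutral_energy c y z "\<lambda>x. f x - D" G N .
  \<comment> \<open>The cases are exhaustive: strictly between the infimum and the supremum,
    \<open>D\<close> is attained by the intermediate value theorem.\<close>
  have "D \<in> range f \<or> (SUP x. ereal (f x)) \<le> ereal D \<or> ereal D \<le> (INF x. ereal (f x))"
  proof (rule ccontr)
    assume *: "\<not> ?thesis"
    then obtain a b where ab: "f a < D" "D < f b"
      by (auto simp: not_le less_SUP_iff INF_less_iff)
    then have "a < b" using mono by (metis less_trans strict_mono_less)
    then have "\<exists>x\<ge>a. x \<le> b \<and> f x = D"
      using ab DERIV_isCont[OF f'] by (intro IVT) auto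
    then show False using * by auto
  qed
  moreover have "globally_attractive c f D d \<and> (\<forall>e. globally_attractive c f D e \<longrightarrow> e = d)"
    if d: "D = f d" for d
  proof (intro conjI allI impI)
    \<comment> \<open>Attractiveness concerns every initial datum, so the reduction is repeated for
      an arbitrary solution \<open>u\<close>, now with the potential normalised to vanish at
      \<open>d\<close>.\<close>
    have "(u \<longlongrightarrow> d) at_top" if u: "ndde_solution c f D u0 u" for u0 u
    proof -
      have "((\<lambda>x. G x - G d) has_real_derivative f x - D) (at x)" for x
        by (auto intro!: derivative_eq_intros G)
      from red[OF u this] obtain w M where "neutral_energy c u w (\<lambda>x. f x - D) (\<lambda>x. G x - G d) M"
        by blast
      then show ?thesis
        by (rule neutral_energy.convergent_to_root[OF _ mono'])
          (use d antiderivative_minimum[OF mono' _ G, of d] in auto)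
    qed
    then show "globally_attractive c f D d"
      unfolding globally_attractive_def using ndde_solution_const[of D f d c, OF d] by blast
    fix e assume "globally_attractive c f D e"
    \<comment> \<open>The constant \<open>d\<close> is an admissible datum whose solution stays at
      \<open>d\<close>, yet it would have to converge to \<open>e\<close>.\<close>
    moreover have "H1_on {-1<..<0} (\<lambda>_. d)"
      by (rule H1_on_const) simp
    ultimately have "((\<lambda>_. d) \<longlongrightarrow> e) (at_top :: real filter)"
      unfolding globally_attractive_def using ndde_solution_const[of D f d c] d by blast
    then show "e = d" by (simp add: tendsto_const_iff)
  qed
  moreover have "filterlim y at_top at_top" if D: "ereal D > (SUP x. ereal (f x))"
  proof -
    \<comment> \<open>A value strictly between the supremum and \<open>D\<close> bounds
      \<open>f x - D\<close> away from 0 uniformly, with \<open>m = (D - r)\<^sup>2\<close> in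
      \<open>potential_at_bot\<close>.\<close>
    obtain r where r: "(SUP x. ereal (f x)) < ereal r" "r < D"
      using ereal_dense2[OF D] by auto
    have fr: "f x < r" for x
      using le_less_trans[OF SUP_upper r(1), of x] by auto
    have sq: "(D - r)\<^sup>2 \<le> (f x - D)\<^sup>2" for x
      using fr[of x] r(2) by (simp flip: abs_le_square_iff)
    have "filterlim (\<lambda>t. G (y t)) at_bot at_top"
      by (rule potential_at_bot[OF _ sq]) (use r in simp)
    then have ev: "eventually (\<lambda>t. G (y t) < G Z) at_top" for Z
      by (simp add: filterlim_at_bot_dense)
    have "f x - D \<le> 0" for x using fr[of x] r(2) by simp
    \<comment> \<open>Since \<open>G\<close> is nonincreasing, \<open>G (y t) < G Z\<close> forces
      \<open>Z < y t\<close>; divergence of the potential thus fixes the direction in which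
      \<open>y\<close> escapes.\<close>
    then have G_le: "G Z \<le> G x" if "x \<le> Z" for x Z
      using that G by (intro DERIV_nonpos_imp_nonincreasing[OF that]) blast
    show ?thesis
      unfolding filterlim_at_top
    proof
      fix Z
      show "eventually (\<lambda>t. Z \<le> y t) at_top"
        using ev[of Z] by eventually_elim (metis G_le linorder_not_le nle_le)
    qed
  qed
  moreover have "filterlim y at_bot at_top" if D: "ereal D < (INF x. ereal (f x))"
  proof -
    obtain r where r: "ereal r < (INF x. ereal (f x))" "D < r"
      using ereal_dense2[OF D] by auto
    have fr: "r < f x" for x
      using less_le_trans[OF r(1) INF_lower, of x] by auto
    have sq: "(r - D)\<^sup>2 \<le> (f x - D)\<^sup>2" for x
      using fr[of x] r(2) by (simp flip: abs_le_square_iff)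
    have "filterlim (\<lambda>t. G (y t)) at_bot at_top"
      by (rule potential_at_bot[OF _ sq]) (use r in simp)
    then have ev: "eventually (\<lambda>t. G (y t) < G Z) at_top" for Z
      by (simp add: filterlim_at_bot_dense)
    have "0 \<le> f x - D" for x using fr[of x] r(2) by simp
    \<comment> \<open>Now \<open>G\<close> is nondecreasing, so the same divergence of the potential
      sends \<open>y\<close> downwards.\<close>
    then have G_le: "G Z \<le> G x" if "Z \<le> x" for x Z
      using that G by (intro DERIV_nonneg_imp_nondecreasing[OF that]) blast
    show ?thesis
      unfolding filterlim_at_bot
    proof
      fix Z
      show "eventually (\<lambda>t. y t \<le> Z) at_top"
        using ev[of Z] by eventually_elim (metis G_le linorder_not_le nle_le)
    qed
  qed
  moreover have "\<not> (\<exists>L. (y \<longlongrightarrow> L) at_top)"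
    if D: "ereal D = (SUP x. ereal (f x)) \<or> ereal D = (INF x. ereal (f x))"
  proof
    assume "\<exists>L. (y \<longlongrightarrow> L) at_top"
    then obtain L where "(y \<longlongrightarrow> L) at_top" by blast
    then have L: "f L = D" using limit_imp_root by force
    \<comment> \<open>A value attained by a strictly increasing function on the whole line is
      neither its supremum nor its infimum.\<close>
    have "f (L - 1) < D" "D < f (L + 1)" using mono L by (auto simp: strict_mono_less)
    then show False
      using D SUP_upper[of "L + 1" UNIV "\<lambda>x. ereal (f x)"] INF_lower[of "L - 1" UNIV "\<lambda>x. ereal (f x)"]
      by (metis UNIV_I ereal_less_eq(3) linorder_not_le)
  qed
  ultimately show ?thesis by blast
qed

end
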